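(* Let $X$ be a real normed space with $\dim X\ge 2$, let $\lambda\in\Lambda_m$ and $1\le p<q\le\infty$. Then $$\mathfrak{C}_{\lambda,q}(X)\le 2^{1/p-1/q}\,\mathfrak{C}_{\lambda,p}(X).$$ Moreover, $$\mathfrak{C}'_{\lambda,q}(X)=2^{1/p-1/q}\,\mathfrak{C}'_{\lambda,p}(X).$$
   Context: $\Lambda$ is the class of all continuous functions $\lambda:[0,\infty)^2\to[0,\infty)$ that are homogeneous of degree one and satisfy $\lambda(1,1)=1$. $\Lambda_m$ is the set of $\lambda\in\Lambda$ that are non-decreasing in each variable. $S_X$ is the unit sphere of $X$. For $(r,s)\in\mathbb{R}^2$, $\|(r,s)\|_p=(|r|^p+|s|^p)^{1/p}$ if $1\le p<\infty$ and $\|(r,s)\|_\infty=\max\{|r|,|s|\}$. For $p\in[1,\infty]$, $$\mathfrak{C}_{\lambda,p}(X)=\sup\{\lambda(\|ru+sv\|,\|su-rv\|):u,v\in S_X,\ r,s\ge0,\ \|(r,s)\|_p=1\},$$ $$\mathfrak{C}'_{\lambda,p}(X)=\sup\{2^{-1/p}\lambda(\|u+v\|,\|u-v\|):u,v\in S_X\},$$ where $1/\infty=0$. *)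

theory Defs
  imports "HOL-Analysis.Analysis"
begin

(* Functions on [0,\<infinity>)^2 are represented by total functions on the plane; only their
   values on the closed quadrant are constrained, and only these are used below. *)

definition Lambda :: "(real \<times> real \<Rightarrow> real) set" where
  "Lambda = {l. l \<in> {0..} \<times> {0..} \<rightarrow> {0..}
               \<and> continuous_on ({0..} \<times> {0..}) l
               \<and> (\<forall>t\<ge>0. \<forall>x\<ge>0. \<forall>y\<ge>0. l (t * x, t * y) = t * l (x, y))
               \<and> l (1, 1) = 1}"

definition Lambda_m :: "(real \<times> real \<Rightarrow> real) set" where
  "Lambda_m = {l \<in> Lambda. (\<forall>y\<ge>0. mono_on {0..} (\<lambda>x. l (x, y)))
                         \<and> (\<forall>x\<ge>0. mono_on {0..} (\<lambda>y. l (x, y)))}"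

(* Exponents live in [1,\<infinity>] as extended reals, where 1 / \<infinity> = 0. *)

definition lp_norm :: "ereal \<Rightarrow> real \<times> real \<Rightarrow> real" where
  "lp_norm p = (\<lambda>(r, s). if p = \<infinity> then max \<bar>r\<bar> \<bar>s\<bar>
      else (\<bar>r\<bar> powr real_of_ereal p + \<bar>s\<bar> powr real_of_ereal p) powr (1 / real_of_ereal p))"

(* The space X is the type 'a. For l in Lambda both sets below are bounded, since l is
   continuous and its arguments stay in the compact square [0,2]^2, and they are nonempty
   if X is nontrivial, so the real-valued Sup is the actual supremum. *)

definition C_const :: "(real \<times> real \<Rightarrow> real) \<Rightarrow> ereal \<Rightarrow> 'a::real_normed_vector itself \<Rightarrow> real" where
  "C_const l p X = Sup {l (norm (r *\<^sub>R u + s *\<^sub>R v), norm (s *\<^sub>R u - r *\<^sub>R v)) | (u::'a) v r s.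
      u \<in> sphere 0 1 \<and> v \<in> sphere 0 1 \<and> 0 \<le> r \<and> 0 \<le> s \<and> lp_norm p (r, s) = 1}"

definition C'_const :: "(real \<times> real \<Rightarrow> real) \<Rightarrow> ereal \<Rightarrow> 'a::real_normed_vector itself \<Rightarrow> real" where
  "C'_const l p X = Sup {2 powr (- real_of_ereal (1 / p)) * l (norm (u + v), norm (u - v)) | (u::'a) v.
      u \<in> sphere 0 1 \<and> v \<in> sphere 0 1}"

end

theory Submission
  imports Defs
begin

text \<open>If \<open>(r, s)\<close> has \<open>q\<close>-norm 1, its \<open>p\<close>-norm \<open>N\<close> is at most \<open>2 powr (1/p - 1/q)\<close> by the power
  mean inequality. Dividing \<open>(r, s)\<close> by \<open>N\<close> makes it admissible for the exponent \<open>p\<close>, and by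
  homogeneity this divides the value of \<open>\<lambda>\<close> by \<open>N\<close>. In the second claim both suprema are multiples
  of one and the same supremum.\<close>

text \<open>Jensen's inequality at the midpoint: the map sending \<open>x\<close> to
  \<open>x powr (Q / P)\<close> is convex because \<open>Q / P\<close> is at least 1. It is applied
  to \<open>a powr P\<close> and \<open>b powr P\<close>, and the result is raised to the power
  \<open>P / Q\<close>.\<close>

lemma two_point_power_mean:
  fixes P Q a b :: real
  assumes PQ: "0 < P" "P < Q" and ab: "0 \<le> a" "0 \<le> b"
  shows "a powr P + b powr P \<le> 2 powr (1 - P / Q) * (a powr Q + b powr Q) powr (P / Q)"
proof (cases "a = 0 \<or> b = 0")
  case True
  \<comment> \<open>Since \<open>0 powr x = 0\<close>, a zero entry drops out of both sums, and only
    the constant factor separates the two sides.\<close>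
  have "1 \<le> (2::real) powr (1 - P / Q)"
    using PQ by (intro ge_one_powr_ge_zero) auto
  then have "x powr P \<le> 2 powr (1 - P / Q) * x powr P" for x :: real
    using mult_right_mono[of 1 _ "x powr P"] by simp
  then show ?thesis
    using True PQ by (auto simp: powr_powr)
next
  case False
  define t where "t = Q / P"
  have t: "t \<ge> 1" "1 / t = P / Q" using PQ by (auto simp: t_def)
  have eq: "(x powr P) powr t = x powr Q" for x :: real
    using PQ by (simp add: powr_powr t_def)
  have "((a powr P + b powr P) / 2) powr t \<le> ((a powr P) powr t + (b powr P) powr t) / 2"
    using convex_onD[OF powr_convex[OF t(1)], of "1/2" "a powr P" "b powr P"] False ab
    by (simp add: field_simps)
  then have "(((a powr P + b powr P) / 2) powr t) powr (1 / t)
      \<le> ((a powr Q + b powr Q) / 2) powr (P / Q)"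
    unfolding eq t(2) using PQ by (intro powr_mono2) auto
  then have "(a powr P + b powr P) / 2 \<le> ((a powr Q + b powr Q) / 2) powr (P / Q)"
    using t(1) by (simp add: powr_powr)
  then show ?thesis
    by (simp add: powr_divide powr_diff field_simps)
qed

lemma lp_norm_scale:
  assumes "1 \<le> p" "0 \<le> c"
  shows "lp_norm p (c * r, c * s) = c * lp_norm p (r, s)"
proof (cases "p = \<infinity>")
  case True
  then show ?thesis
    using assms by (simp add: lp_norm_def abs_mult max_mult_distrib_left)
next
  case False
  then obtain P where P: "p = ereal P" "P \<ge> 1"
    using assms by (cases p) auto
  have "\<bar>c * r\<bar> powr P + \<bar>c * s\<bar> powr P = c powr P * (\<bar>r\<bar> powr P + \<bar>s\<bar> powr P)"
    using assms by (simp add: abs_mult powr_mult algebra_simps)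
  then show ?thesis
    using assms P by (simp add: lp_norm_def powr_mult powr_powr)
qed

text \<open>Serves twice: it keeps the coefficients of an admissible pair in the unit interval,
  which bounds the set behind \<open>C_const\<close>, and it makes the norm of a nonzero pair
  positive, so that the pair can be normalized.\<close>

lemma abs_le_lp_norm:
  assumes "1 \<le> p"
  shows "\<bar>r\<bar> \<le> lp_norm p (r, s)" "\<bar>s\<bar> \<le> lp_norm p (r, s)"
proof -
  have "\<bar>x\<bar> \<le> (\<bar>x\<bar> powr P + y) powr (1 / P)" if "P \<ge> 1" "y \<ge> 0" for x y P :: real
  proof -
    have "(\<bar>x\<bar> powr P) powr (1 / P) \<le> (\<bar>x\<bar> powr P + y) powr (1 / P)"
      using that by (intro powr_mono2) auto
    then show ?thesis
      using that by (simp add: powr_powr)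
  qed
  from this[of _ "\<bar>s\<bar> powr _" r] this[of _ "\<bar>r\<bar> powr _" s]
  show "\<bar>r\<bar> \<le> lp_norm p (r, s)" "\<bar>s\<bar> \<le> lp_norm p (r, s)"
    using assms by (cases p; auto simp: lp_norm_def add.commute)+
qed

text \<open>For finite \<open>q\<close> this is the power mean inequality raised to the power
  \<open>1 / P\<close>; for infinite \<open>q\<close> both entries are replaced by their maximum.
  The factor is sharp, as pairs with equal entries show.\<close>

lemma lp_norm_le_lq_norm:
  assumes pq: "1 \<le> p" "p < q"
  shows "lp_norm p (r, s)
    \<le> 2 powr (real_of_ereal (1 / p) - real_of_ereal (1 / q)) * lp_norm q (r, s)"
proof -
  \<comment> \<open>An exponent strictly below \<open>q\<close> is finite, so only \<open>q\<close>
    needs a case distinction.\<close>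
  obtain P where P: "p = ereal P" "P \<ge> 1"
    using pq by (cases p) auto
  show ?thesis
  proof (cases "q = \<infinity>")
    case True
    define m where "m = max \<bar>r\<bar> \<bar>s\<bar>"
    have "\<bar>r\<bar> powr P + \<bar>s\<bar> powr P \<le> m powr P + m powr P"
      using P by (intro add_mono powr_mono2) (auto simp: m_def)
    then have "(\<bar>r\<bar> powr P + \<bar>s\<bar> powr P) powr (1 / P) \<le> (2 * m powr P) powr (1 / P)"
      using P by (intro powr_mono2) auto
    also have "\<dots> = 2 powr (1 / P) * m"
      using P by (simp add: powr_mult powr_powr m_def)
    finally show ?thesis
      using True P by (simp add: lp_norm_def m_def one_ereal_def)
  next
    case False
    then obtain Q where Q: "q = ereal Q" "P < Q"
      using pq P by (cases q) auto
    have "(\<bar>r\<bar> powr P + \<bar>s\<bar> powr P) powr (1 / P)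
        \<le> (2 powr (1 - P / Q) * (\<bar>r\<bar> powr Q + \<bar>s\<bar> powr Q) powr (P / Q)) powr (1 / P)"
      using P Q by (intro powr_mono2 two_point_power_mean) auto
    also have "\<dots> = 2 powr ((1 - P / Q) * (1 / P)) * (\<bar>r\<bar> powr Q + \<bar>s\<bar> powr Q) powr (1 / Q)"
      using P by (simp add: powr_mult powr_powr)
    also have "(1 - P / Q) * (1 / P) = 1 / P - 1 / Q"
      using P Q by (simp add: field_simps)
    finally show ?thesis
      using P Q by (simp add: lp_norm_def one_ereal_def)
  qed
qed

text \<open>A continuous function is bounded on a compact square. The case \<open>c = 2\<close>
  makes the sets behind both constants bounded above.\<close>

lemma Lambda_bounded_on_square:
  assumes "l \<in> Lambda"
  obtains M where "\<And>x y. 0 \<le> x \<Longrightarrow> x \<le> c \<Longrightarrow> 0 \<le> y \<Longrightarrow> y \<le> c \<Longrightarrow> l (x, y) \<le> M"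
proof -
  have "continuous_on ({0..c} \<times> {0..c}) l"
    using assms by (auto simp: Lambda_def intro: continuous_on_subset)
  then have "compact (l ` ({0..c} \<times> {0..c}))"
    by (intro compact_continuous_image compact_Times) auto
  then have "bdd_above (l ` ({0..c} \<times> {0..c}))"
    by (intro bounded_imp_bdd_above compact_imp_bounded)
  then obtain M where "\<forall>z\<in>{0..c} \<times> {0..c}. l z \<le> M"
    by (auto simp: bdd_above_def)
  then show thesis
    by (intro that[of M]) auto
qed

lemma Lambda_nonneg: "l \<in> Lambda \<Longrightarrow> 0 \<le> x \<Longrightarrow> 0 \<le> y \<Longrightarrow> 0 \<le> l (x, y)"
  by (auto simp: Lambda_def Pi_iff)

lemma Lambda_scale:
  "l \<in> Lambda \<Longrightarrow> 0 \<le> t \<Longrightarrow> 0 \<le> x \<Longrightarrow> 0 \<le> y \<Longrightarrow> l (t * x, t * y) = t * l (x, y)"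
  by (auto simp: Lambda_def)

text \<open>On the reals, \<open>Sup\<close> dominates the members of a set only once the set is
  known to be bounded above; this is what has to be checked here.\<close>

lemma C_const_upper:
  fixes u v :: "'a::real_normed_vector"
  assumes l: "l \<in> Lambda" and p: "1 \<le> p"
    and uv: "norm u = 1" "norm v = 1" and rs: "0 \<le> r" "0 \<le> s" "lp_norm p (r, s) = 1"
  shows "l (norm (r *\<^sub>R u + s *\<^sub>R v), norm (s *\<^sub>R u - r *\<^sub>R v)) \<le> C_const l p TYPE('a)"
  unfolding C_const_def
proof (rule cSup_upper)
  obtain M where M: "\<And>x y. 0 \<le> x \<Longrightarrow> x \<le> 2 \<Longrightarrow> 0 \<le> y \<Longrightarrow> y \<le> 2 \<Longrightarrow> l (x, y) \<le> M"
    using Lambda_bounded_on_square[OF l, where c = 2] by blast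
  have "l (norm (r *\<^sub>R u + s *\<^sub>R v), norm (s *\<^sub>R u - r *\<^sub>R v)) \<le> M"
    if "norm u = 1" "norm v = 1" "0 \<le> r" "0 \<le> s" "lp_norm p (r, s) = 1" for u v :: 'a and r s
  proof -
    \<comment> \<open>Both coefficients are at most 1, so by the triangle inequality both arguments
      of \<open>l\<close> are at most \<open>r + s\<close>, hence at most 2.\<close>
    have "r \<le> 1" "s \<le> 1" using abs_le_lp_norm[OF p, where r = r and s = s] that by auto
    moreover have "norm (r *\<^sub>R u + s *\<^sub>R v) \<le> r + s"
      using norm_triangle_ineq[of "r *\<^sub>R u" "s *\<^sub>R v"] that by simp
    moreover have "norm (s *\<^sub>R u - r *\<^sub>R v) \<le> s + r"
      using norm_triangle_ineq4[of "s *\<^sub>R u" "r *\<^sub>R v"] that by simp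
    ultimately show ?thesis by (intro M) auto
  qed
  then show "bdd_above {l (norm (r *\<^sub>R u + s *\<^sub>R v), norm (s *\<^sub>R u - r *\<^sub>R v)) | (u::'a) v r s.
      u \<in> sphere 0 1 \<and> v \<in> sphere 0 1 \<and> 0 \<le> r \<and> 0 \<le> s \<and> lp_norm p (r, s) = 1}"
    by (intro bdd_aboveI[of _ M]) auto
qed (use uv rs in auto)

lemma C_const_le:
  assumes l: "l \<in> Lambda" and pq: "1 \<le> p" "p < q"
    and ne: "\<exists>u::'a::real_normed_vector. norm u = 1"
  shows "C_const l q TYPE('a)
    \<le> 2 powr (real_of_ereal (1 / p) - real_of_ereal (1 / q)) * C_const l p TYPE('a)"
    (is "_ \<le> ?k * ?C")
  unfolding C_const_def[of l q]
proof (rule cSup_least)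
  obtain u :: 'a where "norm u = 1"
    using ne by blast
  \<comment> \<open>The pair \<open>(1, 0)\<close> is admissible for every exponent; with one unit
    vector in both places it gives a member of the set.\<close>
  moreover have "lp_norm q (1, 0) = 1"
    using pq by (cases q) (auto simp: lp_norm_def)
  ultimately show "{l (norm (r *\<^sub>R u + s *\<^sub>R v), norm (s *\<^sub>R u - r *\<^sub>R v)) | (u::'a) v r s.
      u \<in> sphere 0 1 \<and> v \<in> sphere 0 1 \<and> 0 \<le> r \<and> 0 \<le> s \<and> lp_norm q (r, s) = 1} \<noteq> {}"
    by (force intro!: exI[of _ u] exI[of _ "1::real"] exI[of _ "0::real"])
next
  fix x
  assume "x \<in> {l (norm (r *\<^sub>R u + s *\<^sub>R v), norm (s *\<^sub>R u - r *\<^sub>R v)) | (u::'a) v r s.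
      u \<in> sphere 0 1 \<and> v \<in> sphere 0 1 \<and> 0 \<le> r \<and> 0 \<le> s \<and> lp_norm q (r, s) = 1}"
  then obtain u v :: 'a and r s where x: "x = l (norm (r *\<^sub>R u + s *\<^sub>R v), norm (s *\<^sub>R u - r *\<^sub>R v))"
    and uv: "norm u = 1" "norm v = 1" and rs: "0 \<le> r" "0 \<le> s" "lp_norm q (r, s) = 1"
    by auto
  define N where "N = lp_norm p (r, s)"
  have N_le: "N \<le> ?k"
    using lp_norm_le_lq_norm[OF pq, of r s] rs by (simp add: N_def)
  \<comment> \<open>The zero pair has \<open>q\<close>-norm 0 and is not admissible, so division by
    \<open>N\<close> is legitimate.\<close>
  have "r \<noteq> 0 \<or> s \<noteq> 0"
    using rs pq by (cases q) (auto simp: lp_norm_def)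
  then have N: "N > 0"
    using abs_le_lp_norm[OF pq(1), where r = r and s = s] by (auto simp: N_def)
  define r' s' where "r' = inverse N * r" and "s' = inverse N * s"
  have rs': "r = N * r'" "s = N * s'" "0 \<le> r'" "0 \<le> s'"
    using N rs by (auto simp: r'_def s'_def)
  have 1: "lp_norm p (r', s') = 1"
    using N lp_norm_scale[OF pq(1), of "inverse N" r s] by (simp add: r'_def s'_def N_def)
  have "norm (r *\<^sub>R u + s *\<^sub>R v) = N * norm (r' *\<^sub>R u + s' *\<^sub>R v)"
    "norm (s *\<^sub>R u - r *\<^sub>R v) = N * norm (s' *\<^sub>R u - r' *\<^sub>R v)"
    using N norm_scaleR[of N "r' *\<^sub>R u + s' *\<^sub>R v"] norm_scaleR[of N "s' *\<^sub>R u - r' *\<^sub>R v"]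
    by (simp_all add: rs' scaleR_add_right scaleR_diff_right)
  then have "x = N * l (norm (r' *\<^sub>R u + s' *\<^sub>R v), norm (s' *\<^sub>R u - r' *\<^sub>R v))"
    using N by (simp add: x Lambda_scale[OF l])
  \<comment> \<open>The factors are estimated separately, \<open>N\<close> by the power mean bound
    and the value of \<open>l\<close> by the supremum for \<open>p\<close>; nonnegativity of
    \<open>l\<close> allows the two bounds to be multiplied.\<close>
  also have "\<dots> \<le> ?k * ?C"
    using N N_le rs' 1 uv Lambda_nonneg[OF l]
    by (intro mult_mono C_const_upper[OF l pq(1)]) auto
  finally show "x \<le> ?k * ?C" .
qed

text \<open>Isolates the dependence on \<open>p\<close> in a scalar factor, so that constants for
  different exponents can be compared through their factors alone.\<close>

lemma C'_const_eq:
  assumes l: "l \<in> Lambda" and ne: "\<exists>u::'a::real_normed_vector. norm u = 1"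
  shows "C'_const l p TYPE('a) = 2 powr (- real_of_ereal (1 / p)) *
    Sup {l (norm (u + v), norm (u - v)) | (u::'a) v. u \<in> sphere 0 1 \<and> v \<in> sphere 0 1}"
    (is "_ = ?k * Sup ?S")
proof -
  obtain M where M: "\<And>x y. 0 \<le> x \<Longrightarrow> x \<le> 2 \<Longrightarrow> 0 \<le> y \<Longrightarrow> y \<le> 2 \<Longrightarrow> l (x, y) \<le> M"
    using Lambda_bounded_on_square[OF l, where c = 2] by blast
  have "l (norm (u + v), norm (u - v)) \<le> M" if "norm u = 1" "norm v = 1" for u v :: 'a
    using that norm_triangle_ineq[of u v] norm_triangle_ineq4[of u v] by (intro M) auto
  then have "bdd_above ?S"
    by (intro bdd_aboveI[of _ M]) auto
  moreover have "?S \<noteq> {}"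
    using ne by auto
  \<comment> \<open>Multiplication by a positive constant is monotone and continuous, hence commutes
    with the supremum of a nonempty set that is bounded above.\<close>
  moreover have "mono (\<lambda>x. ?k * x)"
    by (intro monoI mult_left_mono) auto
  ultimately have "?k * Sup ?S = (SUP x\<in>?S. ?k * x)"
    by (intro continuous_at_Sup_mono[where f = "\<lambda>x. ?k * x"] continuous_intros)
  also have "(\<lambda>x. ?k * x) ` ?S = {?k * l (norm (u + v), norm (u - v)) | (u::'a) v.
      u \<in> sphere 0 1 \<and> v \<in> sphere 0 1}"
    by blast
  finally show ?thesis
    by (simp add: C'_const_def)
qed

theorem proposition8:
  fixes l :: "real \<times> real \<Rightarrow> real" and p q :: ereal
  assumes dim: "\<exists>B :: 'a::real_normed_vector set. independent B \<and> card B = 2"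
    and l: "l \<in> Lambda_m"
    and pq: "1 \<le> p" "p < q" "q \<le> \<infinity>"
  shows "C_const l q TYPE('a)
           \<le> 2 powr (real_of_ereal (1 / p) - real_of_ereal (1 / q)) * C_const l p TYPE('a)
       \<and> C'_const l q TYPE('a)
           = 2 powr (real_of_ereal (1 / p) - real_of_ereal (1 / q)) * C'_const l p TYPE('a)"
proof
  have l': "l \<in> Lambda"
    using l by (simp add: Lambda_m_def)
  obtain B :: "'a set" where B: "independent B" "card B = 2"
    using dim by blast
  \<comment> \<open>An independent set with two elements contains a nonzero vector, and normalizing
    it shows that the unit sphere is nonempty.\<close>
  then obtain b where "b \<in> B"
    by fastforce
  then have "b \<noteq> 0"
    using B dependent_zero by blast
  then have ne: "\<exists>u::'a. norm u = 1"
    by (intro exI[of _ "sgn b"]) (simp add: norm_sgn)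
  show "C_const l q TYPE('a)
      \<le> 2 powr (real_of_ereal (1 / p) - real_of_ereal (1 / q)) * C_const l p TYPE('a)"
    by (rule C_const_le[OF l' pq(1,2) ne])
  show "C'_const l q TYPE('a)
      = 2 powr (real_of_ereal (1 / p) - real_of_ereal (1 / q)) * C'_const l p TYPE('a)"
    \<comment> \<open>After both sides are expanded, the exponents \<open>1 / p\<close> cancel and
      leave the factor that belongs to \<open>q\<close>.\<close>
    by (simp add: C'_const_eq[OF l' ne] powr_diff powr_minus field_simps)
qed

end
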